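(* With the setting and notation given in the context, the following hold. (i) If we set $W=Y(I_{n+q}-P)$, where $Y=[0\ \ I_q]\in\mathbb{R}^{q\times(n+q)}$, then the row block $W=[B\ \ S]$ (with $B\in\mathbb{R}^{q\times n}$, $S\in\mathbb{R}^{q\times q}$) is orthogonal to $\bar A$, i.e. $\bar A W^T=0$, hence it is orthogonal to each row block $\bar A_i$, $i=1,\dots,p$. (ii) We have the equalities $$\bar A^+=[\bar A_1^+\ \dots\ \bar A_p^+],\qquad \begin{bmatrix}\bar A\\ W\end{bmatrix}^+=[\bar A^+\ \ W^+],$$ and $$WW^T=BB^T+S^2=S,\qquad\text{where } S=Y(I_{n+q}-P)Y^T\in\mathbb{R}^{q\times q}.$$ (iii) Suppose that the matrix $S$ is invertible and that $f$ is given by $f=-Y\bar A^+b$. Consider the system $$\begin{bmatrix}A&\Gamma\\ B&S\end{bmatrix}\begin{bmatrix}x\\ y\end{bmatrix}=\begin{bmatrix}b\\ f\end{bmatrix},\qquad x\in\mathbb{R}^n,\ y\in\mathbb{R}^q. \qquad(\ast)$$ If $x$ is a solution of the system $Ax=b$, then the vector $\begin{bmatrix}x\\ 0\end{bmatrix}$ is a solution of $(\ast)$. Conversely, if $\begin{bmatrix}x\\ y\end{bmatrix}$ is the minimal norm solution of $(\ast)$, then $y=0$ and $x$ is a solution of $Ax=b$. (iv) The vector $\tilde x$ is a solution of the system $\tilde A\tilde x=\tilde b$ if and only if the vector $Q^T\tilde x$ is a solution of the system $Ax=b$.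
   Context: Let $m\le n$, $q\ge 1$ and $1\le p<m$. Let $\tilde A\in\mathbb{R}^{m\times n}$ have rank $m$ and let $\tilde b\in\mathbb{R}^m$. Let $\Pi\in\mathbb{R}^{m\times m}$ and $Q\in\mathbb{R}^{n\times n}$ be permutation matrices, and put $A=\Pi\tilde A Q$, $b=\Pi\tilde b$. The matrix $A$ is partitioned into row blocks $A_1,\dots,A_p$ with $A_i\in\mathbb{R}^{m_i\times n}$, $m_1+\dots+m_p=m$. Let $\Gamma\in\mathbb{R}^{m\times q}$, partitioned conformally into row blocks $\Gamma_i\in\mathbb{R}^{m_i\times q}$, be such that the row blocks $\bar A_i=[A_i\ \ \Gamma_i]$ of $\bar A=[A\ \ \Gamma]\in\mathbb{R}^{m\times(n+q)}$ are mutually orthogonal, i.e. $\bar A_i\bar A_j^T=0$ for all $i\ne j$. $M^+$ denotes the Moore-Penrose pseudoinverse of a real matrix $M$, and $I_k$ the identity matrix of order $k$. $P=\bar A^+\bar A$ is the orthogonal projector onto the range of $\bar A^T$. The minimal norm solution of a consistent linear system is its unique solution of smallest Euclidean norm. *)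

theory Defs
  imports "Jordan_Normal_Form.DL_Rank"
begin

definition permutation_mat :: "nat \<Rightarrow> real mat \<Rightarrow> bool" where
  "permutation_mat k M \<longleftrightarrow>
     (\<exists>\<sigma>. \<sigma> permutes {..<k} \<and> M = mat k k (\<lambda>(i, j). if j = \<sigma> i then 1 else 0))"

text \<open>The four Penrose equations. For every real matrix \<open>M\<close> they have exactly one solution
  (including matrices without rows or columns), so the description operator in \<open>pinv\<close>
  below picks out the Moore-Penrose pseudoinverse.\<close>

definition is_pinv :: "real mat \<Rightarrow> real mat \<Rightarrow> bool" where
  "is_pinv M X \<longleftrightarrow>
     X \<in> carrier_mat (dim_col M) (dim_row M) \<and>
     M * X * M = M \<and>
     X * M * X = X \<and>
     transpose_mat (M * X) = M * X \<and>
     transpose_mat (X * M) = X * M"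

definition pinv :: "real mat \<Rightarrow> real mat" where
  "pinv M = (THE X. is_pinv M X)"

definition append_cols :: "real mat \<Rightarrow> real mat \<Rightarrow> real mat" (infixr \<open>@\<^sub>c\<close> 65) where
  "M @\<^sub>c N = four_block_mat M N (0\<^sub>m 0 (dim_col M)) (0\<^sub>m 0 (dim_col N))"

text \<open>\<open>concat_cols k [M\<^sub>0, \<dots>, M\<^sub>l]\<close> is the block row formed by the matrices \<open>M\<^sub>0, \<dots>, M\<^sub>l\<close>,
  all of which have \<open>k\<close> rows.\<close>

definition concat_cols :: "nat \<Rightarrow> real mat list \<Rightarrow> real mat" where
  "concat_cols k Ms = mat_of_cols k (concat (map cols Ms))"

text \<open>Row blocks are indexed from \<open>0\<close>: for block sizes \<open>r 0, r 1, \<dots>\<close>, block \<open>i\<close> consists of the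
  \<open>r i\<close> consecutive rows that come after the first \<open>r 0 + \<dots> + r (i - 1)\<close> rows.\<close>

definition row_block :: "(nat \<Rightarrow> nat) \<Rightarrow> real mat \<Rightarrow> nat \<Rightarrow> real mat" where
  "row_block r M i = mat (r i) (dim_col M) (\<lambda>(k, j). M $$ ((\<Sum>l<i. r l) + k, j))"

definition is_solution :: "real mat \<Rightarrow> real vec \<Rightarrow> real vec \<Rightarrow> bool" where
  "is_solution M c z \<longleftrightarrow> z \<in> carrier_vec (dim_col M) \<and> M *\<^sub>v z = c"

definition euclidean_norm :: "real vec \<Rightarrow> real" where
  "euclidean_norm v = sqrt (v \<bullet> v)"

definition is_min_norm_solution :: "real mat \<Rightarrow> real vec \<Rightarrow> real vec \<Rightarrow> bool" where
  "is_min_norm_solution M c z \<longleftrightarrow>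
     is_solution M c z \<and>
     (\<forall>w. is_solution M c w \<and> w \<noteq> z \<longrightarrow> euclidean_norm z < euclidean_norm w)"

end

theory Submission
  imports Defs
begin

text \<open>A real matrix \<open>A\<close> has a generalized inverse \<open>G\<close>, read off its echelon form; applied to \<open>A\<^sup>T A\<close>
  it gives \<open>X = G A\<^sup>T\<close> with \<open>A X A = A\<close> and \<open>A X\<close> symmetric. Together with the transposed
  construction \<open>U\<close>, for which \<open>U A\<close> is symmetric, \<open>U A X\<close> is the Moore-Penrose pseudoinverse.

  For blocks with \<open>M N\<^sup>T = 0\<close> also \<open>M N\<^sup>+ = 0\<close>, because the range of \<open>N\<^sup>+\<close> lies in that of \<open>N\<^sup>T\<close>; hence
  the pseudoinverse of a stack of mutually orthogonal blocks is the row of their pseudoinverses.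

  For (iii), put \<open>w = Abar\<^sup>+ b + W\<^sup>T u\<close> with \<open>S u = f\<close>. This \<open>w\<close> solves the system and lies in the range of
  its transposed matrix, so it is the minimal norm solution; moreover
  \<open>Y w = Y Abar\<^sup>+ b + S u = 0\<close>.\<close>

text \<open>Hypotheses on \<open>dim_col\<close> and \<open>dim_row\<close> leave no intermediate
  size to be guessed, so the simplifier can use this rule to rebracket long products to the
  right.\<close>

lemma mult_mat_assoc:
  fixes A B C :: "'a :: semiring_0 mat"
  assumes "dim_col A = dim_row B" "dim_col B = dim_row C"
  shows "A * B * C = A * (B * C)"
  using assms by (intro assoc_mult_mat) auto

lemma mult_mat_vec_assoc:
  fixes A B :: "'a :: semiring_0 mat"
  assumes "dim_col A = dim_row B" "dim_col B = dim_vec v"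
  shows "(A * B) *\<^sub>v v = A *\<^sub>v (B *\<^sub>v v)"
  using assms by (intro assoc_mult_mat_vec) auto

lemma zero_mat_mult_vec: "v \<in> carrier_vec n \<Longrightarrow> 0\<^sub>m m n *\<^sub>v v = 0\<^sub>v m"
  by (intro eq_vecI) auto

lemma transpose_mat_mult:
  fixes A B :: "'a :: comm_semiring_0 mat"
  assumes "dim_col A = dim_row B"
  shows "(A * B)\<^sup>T = B\<^sup>T * A\<^sup>T"
  using assms by (intro transpose_mult) auto

section \<open>Products and transposes of block matrices\<close>

lemma append_cols_carrier [simp, intro]:
  "A \<in> carrier_mat k a \<Longrightarrow> B \<in> carrier_mat k b \<Longrightarrow> A @\<^sub>c B \<in> carrier_mat k (a + b)"
  unfolding append_cols_def by auto

lemma append_rows_mult: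
  fixes A :: "'a :: semiring_0 mat"
  assumes "A \<in> carrier_mat a k" "B \<in> carrier_mat b k" "C \<in> carrier_mat k c"
  shows "(A @\<^sub>r B) * C = (A * C) @\<^sub>r (B * C)"
  using assms unfolding append_rows_def
  by (intro eq_matI) (auto simp: row_def scalar_prod_def intro!: sum.cong)

lemma mult_append_cols:
  assumes "A \<in> carrier_mat c k" "B \<in> carrier_mat k a" "C \<in> carrier_mat k b"
  shows "A * (B @\<^sub>c C) = (A * B) @\<^sub>c (A * C)"
  using assms unfolding append_cols_def
  by (intro eq_matI) (auto simp: col_def scalar_prod_def intro!: sum.cong)

lemma append_rows_mult_append_cols:
  assumes "A \<in> carrier_mat a k" "B \<in> carrier_mat b k"
    and "C \<in> carrier_mat k c" "D \<in> carrier_mat k d"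
  shows "(A @\<^sub>r B) * (C @\<^sub>c D) = four_block_mat (A * C) (A * D) (B * C) (B * D)"
  using assms unfolding append_cols_def append_rows_def
  by (intro eq_matI) (auto simp: col_def row_def scalar_prod_def intro!: sum.cong)

lemma append_cols_mult_append_rows:
  assumes "A \<in> carrier_mat k a" "B \<in> carrier_mat k b"
    and "C \<in> carrier_mat a c" "D \<in> carrier_mat b c"
  shows "(A @\<^sub>c B) * (C @\<^sub>r D) = A * C + B * D"
proof -
  \<comment> \<open>Both factors are four-block matrices with empty lower or right blocks, so the
    block product is the wanted sum bordered by empty blocks.\<close>
  have "(A @\<^sub>c B) * (C @\<^sub>r D) =
      four_block_mat (A * C + B * D) (0\<^sub>m k 0) (0\<^sub>m 0 c) (0\<^sub>m 0 0)"
    unfolding append_cols_def append_rows_def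
    using assms by (subst mult_four_block_mat[of _ k a _ b _ 0 _ _ c _ 0]) auto
  also have "\<dots> = A * C + B * D"
    using assms by (intro eq_matI) auto
  finally show ?thesis .
qed

lemma transpose_append_cols:
  assumes "A \<in> carrier_mat k a" "B \<in> carrier_mat k b"
  shows "(A @\<^sub>c B)\<^sup>T = A\<^sup>T @\<^sub>r B\<^sup>T"
  using assms unfolding append_cols_def append_rows_def by (intro eq_matI) auto

lemma transpose_append_rows:
  assumes "A \<in> carrier_mat a k" "B \<in> carrier_mat b k"
  shows "(A @\<^sub>r B)\<^sup>T = A\<^sup>T @\<^sub>c B\<^sup>T"
  using assms unfolding append_cols_def append_rows_def by (intro eq_matI) auto

lemma append_cols_mult_append_vec:
  assumes "A \<in> carrier_mat k a" "B \<in> carrier_mat k b"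
    and "v \<in> carrier_vec a" "w \<in> carrier_vec b"
  shows "(A @\<^sub>c B) *\<^sub>v (v @\<^sub>v w) = A *\<^sub>v v + B *\<^sub>v w"
  using assms unfolding append_cols_def
  by (subst four_block_mat_mult_vec[of _ k a _ b _ 0]) (auto intro!: eq_vecI)

lemma four_block_mat_append_rows_cols:
  assumes "A \<in> carrier_mat a c" "B \<in> carrier_mat a d" "C \<in> carrier_mat b c" "D \<in> carrier_mat b d"
  shows "four_block_mat A B C D = (A @\<^sub>c B) @\<^sub>r (C @\<^sub>c D)"
  using assms unfolding append_cols_def append_rows_def by (intro eq_matI) auto

section \<open>Generalized and least-squares inverses\<close>

lemma transpose_mult_self_eq_0:
  fixes A :: "real mat"
  assumes A: "A \<in> carrier_mat m n" and "A\<^sup>T * A = 0\<^sub>m n n"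
  shows "A = 0\<^sub>m m n"
proof (rule eq_matI)
  fix i j assume ij: "i < dim_row (0\<^sub>m m n)" "j < dim_col (0\<^sub>m m n)"
  have "col A j \<bullet> col A j = (A\<^sup>T * A) $$ (j, j)" using A ij by simp
  also have "\<dots> = 0" using assms ij by simp
  \<comment> \<open>Over the reals conjugation is the identity, so this is positive definiteness of
    the scalar product.\<close>
  finally have "col A j = 0\<^sub>v m"
    using conjugate_square_eq_0_vec[of "col A j" m] A by (simp add: carrier_vecI)
  then have "col A j $ i = 0" using ij by simp
  then show "A $$ (i, j) = 0\<^sub>m m n $$ (i, j)" using A ij by simp
qed (use A in auto)

text \<open>The pivot column of a nonzero row \<open>i\<close> is the \<open>i\<close>-th unit
  vector. Sending that unit vector back to the pivot position makes \<open>C * G\<close> the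
  diagonal indicator \<open>E\<close> of the nonzero rows, and \<open>E\<close> fixes
  \<open>C\<close>.\<close>

lemma row_echelon_generalized_inverse:
  fixes C :: "'a :: field mat"
  assumes C: "C \<in> carrier_mat m n" and "row_echelon_form C"
  shows "\<exists>G \<in> carrier_mat n m. C * G * C = C"
proof -
  from assms obtain f where f: "pivot_fun C f n" unfolding row_echelon_form_def by auto
  note p = pivot_funD[OF _ f, of m]
  \<comment> \<open>A zero row has \<open>f i = n\<close>, which no index \<open>k < n\<close>
    meets, so its column in \<open>G\<close> is zero.\<close>
  define G :: "'a mat" where "G = mat n m (\<lambda>(k, i). if k = f i then 1 else 0)"
  have G: "G \<in> carrier_mat n m" by (simp add: G_def)
  define E :: "'a mat" where
    "E = mat m m (\<lambda>(i, j). if i = j \<and> f j < n then 1 else 0)"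
  have E: "E \<in> carrier_mat m m" by (simp add: E_def)
  have "C * G = E"
  proof (rule eq_matI)
    fix i j assume "i < dim_row E" "j < dim_col E"
    then have ij: "i < m" "j < m" using E by auto
    have "(C * G) $$ (i, j) = (\<Sum>k<n. C $$ (i, k) * (if k = f j then 1 else 0))"
      using C G ij by (auto simp: scalar_prod_def G_def atLeast0LessThan)
    also have "\<dots> = (if f j < n then C $$ (i, f j) else 0)"
      by (simp add: if_distrib[of "(*) _"] sum.delta cong: if_cong)
    also have "\<dots> = E $$ (i, j)"
      using p(4)[of j] p(5)[of j i] C ij by (auto simp: E_def)
    finally show "(C * G) $$ (i, j) = E $$ (i, j)" .
  qed (use C G E in auto)
  moreover have "E * C = C"
  proof (rule eq_matI)
    fix i j assume "i < dim_row C" "j < dim_col C"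
    then have ij: "i < m" "j < n" using C by auto
    have "(E * C) $$ (i, j) = (\<Sum>k<m. (if i = k \<and> f k < n then 1 else 0) * C $$ (k, j))"
      using C E ij by (auto simp: scalar_prod_def E_def atLeast0LessThan)
    also have "\<dots> = (\<Sum>k<m. if k = i then (if f i < n then C $$ (i, j) else 0) else 0)"
      by (intro sum.cong) auto
    also have "\<dots> = (if f i < n then C $$ (i, j) else 0)"
      using ij by (simp add: sum.delta)
    also have "\<dots> = C $$ (i, j)"
      using p(1)[of i] p(2)[of i j] C ij by auto
    finally show "(E * C) $$ (i, j) = C $$ (i, j)" .
  qed (use C E in auto)
  ultimately show ?thesis using G by auto
qed

text \<open>Gauss-Jordan elimination gives \<open>C = P * A\<close> and \<open>A = Q * C\<close>, so
  a generalized inverse \<open>G\<close> of \<open>C\<close> turns into \<open>G * P\<close> for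
  \<open>A\<close>.\<close>

lemma generalized_inverse_exists:
  fixes A :: "'a :: field mat"
  assumes A: "A \<in> carrier_mat m n"
  shows "\<exists>G \<in> carrier_mat n m. A * G * A = A"
proof -
  define C where "C = gauss_jordan_single A"
  note gj = gauss_jordan_single[OF A C_def[symmetric]]
  from gj(4) obtain P Q where CPA: "C = P * A" and P: "P \<in> carrier_mat m m"
    and Q: "Q \<in> carrier_mat m m" and QP: "Q * P = 1\<^sub>m m" by auto
  from row_echelon_generalized_inverse[OF gj(2,3)]
  obtain G where G: "G \<in> carrier_mat n m" and CGC: "C * G * C = C" by auto
  have A_eq: "A = Q * C"
    using A P Q QP by (simp add: CPA assoc_mult_mat[of Q m m P m A n, symmetric])
  have "A * (G * P) * A = Q * C * G * P * A"
    using A P Q G gj(2) A_eq by (simp add: mult_mat_assoc)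
  also have "\<dots> = Q * (C * G * C)"
    unfolding CPA using A P Q G by (simp add: mult_mat_assoc)
  also have "\<dots> = A" by (simp add: CGC A_eq)
  finally show ?thesis using G P by (intro bexI[of _ "G * P"]) auto
qed

text \<open>With \<open>G\<close> a generalized inverse of the Gram matrix,
  \<open>K = A * G * A\<^sup>T\<close> is the orthogonal projector onto the column space of
  \<open>A\<close>. The proof must cancel \<open>A\<^sup>T\<close> on the left, which definiteness
  permits, and then obtain the symmetry of \<open>K\<close>.\<close>

lemma least_squares_inverse_exists:
  fixes A :: "real mat"
  assumes A: "A \<in> carrier_mat m n"
  shows "\<exists>X \<in> carrier_mat n m. A * X * A = A \<and> (A * X)\<^sup>T = A * X"
proof -
  have At: "A\<^sup>T \<in> carrier_mat n m" using A by simp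
  obtain G where G: "G \<in> carrier_mat n n" and GI: "A\<^sup>T * A * G * (A\<^sup>T * A) = A\<^sup>T * A"
    using generalized_inverse_exists[of "A\<^sup>T * A" n n] A by auto
  define K where "K = A * G * A\<^sup>T"
  have K: "K \<in> carrier_mat m m" unfolding K_def using A G by simp
  define D where "D = K * A - A"
  have D: "D \<in> carrier_mat m n" unfolding D_def using A K by (intro minus_carrier_mat)
  have "A\<^sup>T * D = A\<^sup>T * (K * A) - A\<^sup>T * A"
    unfolding D_def by (rule mult_minus_distrib_mat[OF At _ A]) (use K A in auto)
  also have "A\<^sup>T * (K * A) = A\<^sup>T * A * G * (A\<^sup>T * A)"
    unfolding K_def using A G by (simp add: mult_mat_assoc)
  finally have AtD: "A\<^sup>T * D = 0\<^sub>m n n" using GI A by simp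
  \<comment> \<open>The columns of \<open>D\<close> lie in the column space of \<open>A\<close>
    while \<open>A\<^sup>T\<close> kills them; hence \<open>D\<^sup>T * D\<close> vanishes.\<close>
  have D_eq: "D = A * (G * (A\<^sup>T * A) - 1\<^sub>m n)"
    unfolding D_def K_def
    by (subst mult_minus_distrib_mat[of _ m n]) (use A G in \<open>auto simp: mult_mat_assoc\<close>)
  have c: "G * (A\<^sup>T * A) - 1\<^sub>m n \<in> carrier_mat n n" by (intro minus_carrier_mat) simp
  have "D\<^sup>T * D = (G * (A\<^sup>T * A) - 1\<^sub>m n)\<^sup>T * (A\<^sup>T * D)"
    by (subst D_eq, subst transpose_mult[OF A c]) (use c At D in simp)
  also have "\<dots> = 0\<^sub>m n n" using c by (simp add: AtD)
  finally have "D = 0\<^sub>m m n" using transpose_mult_self_eq_0[OF D] by simp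
  then have KA: "K * A = A"
    unfolding D_def using A K
    by (intro eq_matI) (auto simp: mat_eq_iff)
  have Kt: "K\<^sup>T = A * G\<^sup>T * A\<^sup>T"
    unfolding K_def using A G by (simp add: transpose_mat_mult mult_mat_assoc)
  \<comment> \<open>\<open>G\<close> may fail to be symmetric; the symmetry of \<open>K\<close>
    comes from writing \<open>K\<^sup>T\<close> as the symmetric product
    \<open>K * K\<^sup>T\<close>.\<close>
  have "K * K\<^sup>T = (K * A) * (G\<^sup>T * A\<^sup>T)"
    unfolding Kt using K A G by (simp add: mult_mat_assoc)
  also have "\<dots> = K\<^sup>T" unfolding KA Kt using A G At by simp
  finally have "K\<^sup>T = K * K\<^sup>T" by simp
  then have "K\<^sup>T = K"
    by (metis K transpose_mult transpose_transpose transpose_carrier_mat)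
  moreover have "A * (G * A\<^sup>T) = K" unfolding K_def using A G At by simp
  ultimately show ?thesis using G At KA by (intro bexI[of _ "G * A\<^sup>T"]) auto
qed

section \<open>Existence and uniqueness of the Moore-Penrose pseudoinverse\<close>

lemma is_pinvD:
  assumes "is_pinv M X"
  shows "X \<in> carrier_mat (dim_col M) (dim_row M)" "M * X * M = M" "X * M * X = X"
    "(M * X)\<^sup>T = M * X" "(X * M)\<^sup>T = X * M"
  using assms unfolding is_pinv_def by auto

lemma is_pinv_exists: "\<exists>X. is_pinv M X"
proof -
  define m n where "m = dim_row M" and "n = dim_col M"
  have M: "M \<in> carrier_mat m n" by (simp add: m_def n_def)
  obtain X where X: "X \<in> carrier_mat n m" "M * X * M = M" "(M * X)\<^sup>T = M * X"
    using least_squares_inverse_exists[OF M] by auto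
  obtain Z where Z: "Z \<in> carrier_mat m n" "M\<^sup>T * Z * M\<^sup>T = M\<^sup>T" "(M\<^sup>T * Z)\<^sup>T = M\<^sup>T * Z"
    using least_squares_inverse_exists[of "M\<^sup>T" n m] M by auto
  define U where "U = Z\<^sup>T"
  have U: "U \<in> carrier_mat n m" unfolding U_def using Z by simp
  have MUM: "M * U * M = M"
    using arg_cong[OF Z(2), of transpose_mat] M Z(1) unfolding U_def
    by (simp add: transpose_mat_mult mult_mat_assoc)
  have UM: "(U * M)\<^sup>T = U * M"
    using Z(3) M Z(1) unfolding U_def by (simp add: transpose_mat_mult)
  \<comment> \<open>This product keeps the good side of each factor: \<open>M * V = M * X\<close>
    and \<open>V * M = U * M\<close>, both symmetric.\<close>
  define V where "V = U * M * X"
  have V: "V \<in> carrier_mat n m" unfolding V_def using U M X by simp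
  have MV: "M * V = M * X"
  proof -
    have "M * V = M * U * M * X" unfolding V_def using M U X by (simp add: mult_mat_assoc)
    then show ?thesis by (simp only: MUM)
  qed
  have VM: "V * M = U * M"
  proof -
    have "V * M = U * (M * X * M)" unfolding V_def using M U X by (simp add: mult_mat_assoc)
    then show ?thesis by (simp only: X(2))
  qed
  have "V * M * V = U * M * V" by (simp only: VM)
  also have "\<dots> = U * (M * V)" using U M V by (simp add: mult_mat_assoc)
  also have "\<dots> = V" by (simp only: MV) (use U M X in \<open>simp add: V_def mult_mat_assoc\<close>)
  finally have "V * M * V = V" .
  then have "is_pinv M V"
    unfolding is_pinv_def using V M MV VM X UM by auto
  then show ?thesis by blast
qed

text \<open>Two solutions yield the same projectors \<open>M * X = M * Z\<close> and
  \<open>X * M = Z * M\<close>; then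
  \<open>X = X * M * X = X * M * Z = Z * M * Z = Z\<close>.\<close>

lemma is_pinv_unique:
  assumes "is_pinv M X" "is_pinv M Z"
  shows "X = Z"
proof -
  note X = is_pinvD[OF assms(1)] and Z = is_pinvD[OF assms(2)]
  note [simp] = carrier_matD[OF X(1)] carrier_matD[OF Z(1)]
  have "M * X = (M * X)\<^sup>T" by (simp only: X(4))
  also have "\<dots> = ((M * Z) * (M * X))\<^sup>T"
    by (subst (1) Z(2)[symmetric], subst mult_mat_assoc) auto
  also have "\<dots> = (M * X) * (M * Z)" by (subst transpose_mat_mult) (simp_all only: X(4) Z(4), auto)
  also have "\<dots> = M * X * M * Z" by (subst mult_mat_assoc) (auto simp: mult_mat_assoc)
  finally have MX: "M * X = M * Z" by (simp only: X(2))
  have "X * M = (X * M)\<^sup>T" by (simp only: X(5))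
  also have "\<dots> = ((X * M) * (Z * M))\<^sup>T"
    by (subst (1) Z(2)[symmetric]) (simp add: mult_mat_assoc)
  also have "\<dots> = (Z * M) * (X * M)" by (subst transpose_mat_mult) (simp_all only: X(5) Z(5), auto)
  also have "\<dots> = Z * (M * X * M)" by (simp add: mult_mat_assoc)
  finally have XM: "X * M = Z * M" by (simp only: X(2))
  have "X = X * (M * X)" using X by (simp add: mult_mat_assoc)
  also have "\<dots> = X * M * Z" by (simp add: MX mult_mat_assoc)
  also have "\<dots> = Z" using Z by (simp add: XM)
  finally show ?thesis .
qed

lemma is_pinv_pinv: "is_pinv M (pinv M)"
  unfolding pinv_def using is_pinv_exists is_pinv_unique by (metis theI')

lemma pinv_eqI: "is_pinv M X \<Longrightarrow> pinv M = X"
  using is_pinv_pinv is_pinv_unique by blast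

lemmas pinv = is_pinvD[OF is_pinv_pinv]

lemma pinv_carrier [simp, intro]: "M \<in> carrier_mat m n \<Longrightarrow> pinv M \<in> carrier_mat n m"
  using pinv(1)[of M] by auto

lemma dim_pinv [simp]: "dim_row (pinv M) = dim_col M" "dim_col (pinv M) = dim_row M"
  using carrier_matD[OF pinv(1)[of M]] by simp_all

section \<open>Pseudoinverses of stacked orthogonal blocks\<close>

lemma mult_pinv_eq_0:
  assumes M: "M \<in> carrier_mat m k" and N: "N \<in> carrier_mat n k"
    and 0: "M * N\<^sup>T = 0\<^sub>m m n"
  shows "M * pinv N = 0\<^sub>m m n"
proof -
  have X: "pinv N \<in> carrier_mat k n" using N by auto
  have "pinv N = (pinv N * N)\<^sup>T * pinv N" by (simp add: pinv)
  also have "\<dots> = N\<^sup>T * ((pinv N)\<^sup>T * pinv N)"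
    using N X by (simp add: transpose_mat_mult mult_mat_assoc)
  finally have "M * pinv N = M * (N\<^sup>T * ((pinv N)\<^sup>T * pinv N))" by simp
  also have "\<dots> = M * N\<^sup>T * ((pinv N)\<^sup>T * pinv N)"
    using M N X by (simp add: mult_mat_assoc)
  also have "\<dots> = 0\<^sub>m m n"
    unfolding 0 using X by (intro left_mult_zero_mat[of _ n n]) auto
  finally show ?thesis .
qed

text \<open>The cross products \<open>M * pinv N\<close> and \<open>N * pinv M\<close> vanish. So
  one product of stack and candidate is block diagonal, the other is a sum of two projectors, and
  the Penrose equations split into those of \<open>M\<close> and \<open>N\<close>.\<close>

lemma pinv_append_rows:
  assumes M: "M \<in> carrier_mat m k" and N: "N \<in> carrier_mat n k"
    and 0: "M * N\<^sup>T = 0\<^sub>m m n"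
  shows "pinv (M @\<^sub>r N) = pinv M @\<^sub>c pinv N"
proof (rule pinv_eqI)
  define X Z where "X = pinv M" and "Z = pinv N"
  have X: "X \<in> carrier_mat k m" and Z: "Z \<in> carrier_mat k n"
    using M N by (auto simp: X_def Z_def)
  note pX = pinv[of M, folded X_def] and pZ = pinv[of N, folded Z_def]
  have "N * M\<^sup>T = (M * N\<^sup>T)\<^sup>T" using M N by (simp add: transpose_mat_mult)
  then have NM: "N * M\<^sup>T = 0\<^sub>m n m" by (simp add: 0)
  have MZ: "M * Z = 0\<^sub>m m n" and NX: "N * X = 0\<^sub>m n m"
    unfolding X_def Z_def using mult_pinv_eq_0 M N 0 NM by auto
  let ?M = "M @\<^sub>r N" and ?X = "X @\<^sub>c Z"
  have c: "?M \<in> carrier_mat (m + n) k" "?X \<in> carrier_mat k (m + n)"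
    using M N X Z by auto
  have MX: "?M * ?X = four_block_mat (M * X) (0\<^sub>m m n) (0\<^sub>m n m) (N * Z)"
    using M N X Z by (simp add: append_rows_mult_append_cols MZ NX)
  have XM: "?X * ?M = X * M + Z * N"
    using M N X Z by (rule append_cols_mult_append_rows[rotated 2])
  have MXM: "M * (X * M + Z * N) = M" "N * (X * M + Z * N) = N"
  proof -
    have "M * (X * M + Z * N) = M * X * M + M * Z * N"
      using M N X Z by (simp add: mult_add_distrib_mat[of M m k _ k] mult_mat_assoc)
    then show "M * (X * M + Z * N) = M" using M N by (simp add: MZ pX)
    have "N * (X * M + Z * N) = N * X * M + N * Z * N"
      using M N X Z by (simp add: mult_add_distrib_mat[of N n k _ k] mult_mat_assoc)
    then show "N * (X * M + Z * N) = N" using M N by (simp add: NX pZ)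
  qed
  have XMX: "(X * M + Z * N) * X = X" "(X * M + Z * N) * Z = Z"
  proof -
    have "(X * M + Z * N) * X = X * M * X + Z * (N * X)"
      using M N X Z by (simp add: add_mult_distrib_mat[of _ k k] mult_mat_assoc)
    then show "(X * M + Z * N) * X = X" using X Z by (simp add: NX pX)
    have "(X * M + Z * N) * Z = X * (M * Z) + Z * N * Z"
      using M N X Z by (simp add: add_mult_distrib_mat[of _ k k] mult_mat_assoc)
    then show "(X * M + Z * N) * Z = Z" using X Z by (simp add: MZ pZ)
  qed
  have "?M * ?X * ?M = ?M * (?X * ?M)" using c by (simp add: mult_mat_assoc)
  also have "\<dots> = ?M"
    unfolding XM by (subst append_rows_mult[OF M N, of _ k]) (use M N X Z in \<open>auto simp: MXM\<close>)
  finally have 1: "?M * ?X * ?M = ?M" .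
  have 2: "?X * ?M * ?X = ?X"
    unfolding XM by (subst mult_append_cols[OF _ X Z, of _ k]) (use M N X Z in \<open>auto simp: XMX\<close>)
  have 3: "(?M * ?X)\<^sup>T = ?M * ?X"
    unfolding MX using M N X Z
    by (subst transpose_four_block_mat[of _ m m _ n _ n]) (auto simp: pX pZ)
  have 4: "(?X * ?M)\<^sup>T = ?X * ?M"
    unfolding XM using M N X Z by (subst transpose_add[of _ k k]) (auto simp: pX pZ)
  show "is_pinv (M @\<^sub>r N) (pinv M @\<^sub>c pinv N)"
    unfolding is_pinv_def X_def[symmetric] Z_def[symmetric] using 1 2 3 4 c by auto
qed

lemma concat_cols_Nil [simp]: "concat_cols k [] = 0\<^sub>m k 0"
  unfolding concat_cols_def by (intro eq_matI) auto

lemma concat_cols_snoc: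
  assumes "X \<in> carrier_mat k c"
  shows "concat_cols k (Xs @ [X]) = concat_cols k Xs @\<^sub>c X"
  using assms unfolding concat_cols_def append_cols_def
  by (intro eq_matI) (auto simp: mat_of_cols_index nth_append)

text \<open>With \<open>k\<close> a partial sum of block sizes this is the stack of the first
  blocks, on which \<open>pinv_row_blocks\<close> inducts.\<close>

definition top_rows :: "nat \<Rightarrow> real mat \<Rightarrow> real mat" where
  "top_rows k M = mat k (dim_col M) (\<lambda>ij. M $$ ij)"

lemma top_rows_carrier [simp]: "M \<in> carrier_mat m n \<Longrightarrow> top_rows k M \<in> carrier_mat k n"
  unfolding top_rows_def by auto

lemma row_block_carrier [simp]:
  "M \<in> carrier_mat m n \<Longrightarrow> row_block r M i \<in> carrier_mat (r i) n"
  unfolding row_block_def by auto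

lemma top_rows_Suc:
  "top_rows (\<Sum>l<Suc i. r l) M = top_rows (\<Sum>l<i. r l) M @\<^sub>r row_block r M i"
  unfolding top_rows_def row_block_def append_rows_def by (intro eq_matI) auto

lemma append_rows_0: "0\<^sub>m a c @\<^sub>r 0\<^sub>m b c = 0\<^sub>m (a + b) c"
  unfolding append_rows_def by (intro eq_matI) auto

lemma row_block_mult:
  assumes M: "M \<in> carrier_mat m n" and C: "C \<in> carrier_mat n c"
    and "(\<Sum>l<p. r l) = m" "i < p"
  shows "row_block r M i * C = row_block r (M * C) i"
proof -
  \<comment> \<open>Block \<open>i\<close> has to end within the \<open>m\<close> rows, since
    entries beyond the dimensions of a matrix are unspecified.\<close>
  have "(\<Sum>l<Suc i. r l) \<le> (\<Sum>l<p. r l)" using \<open>i < p\<close> by (intro sum_mono2) auto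
  then have "(\<Sum>l<i. r l) + r i \<le> m" using assms by simp
  then show ?thesis
    using M C unfolding row_block_def
    by (intro eq_matI) (auto simp: scalar_prod_def intro!: sum.cong)
qed

text \<open>Blocks are added one at a time: each is orthogonal to every earlier one, hence to their
  stack, and \<open>pinv_append_rows\<close> applies.\<close>

lemma pinv_row_blocks:
  fixes M :: "real mat"
  assumes M: "M \<in> carrier_mat m n" and m: "(\<Sum>i<p. r i) = m"
    and orth: "\<And>i j. i < p \<Longrightarrow> j < p \<Longrightarrow> i \<noteq> j \<Longrightarrow>
      row_block r M i * (row_block r M j)\<^sup>T = 0\<^sub>m (r i) (r j)"
  shows "pinv M = concat_cols n (map (\<lambda>i. pinv (row_block r M i)) [0..<p])"
proof -
  let ?s = "\<lambda>k. \<Sum>i<k. r i"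
  have top_orth: "top_rows (?s k) M * (row_block r M j)\<^sup>T = 0\<^sub>m (?s k) (r j)"
    if "k \<le> j" "j < p" for k j
    using that
  proof (induction k)
    case 0
    show ?case using M by (intro eq_matI) (auto simp: top_rows_def row_block_def)
  next
    case (Suc k)
    then show ?case
      unfolding top_rows_Suc
      by (subst append_rows_mult[OF top_rows_carrier[OF M] row_block_carrier[OF M], of _ "r j"])
        (use M in \<open>auto simp: orth append_rows_0\<close>)
  qed
  have "pinv (top_rows (?s k) M) = concat_cols n (map (\<lambda>i. pinv (row_block r M i)) [0..<k])"
    if "k \<le> p" for k
    using that
  proof (induction k)
    case 0
    \<comment> \<open>Without columns there are no entries to compare, so the dimensions settle the
      base case.\<close>
    have "pinv (top_rows (?s 0) M) \<in> carrier_mat n 0" using M by simp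
    then show ?case by (intro eq_matI) auto
  next
    case (Suc k)
    have "pinv (top_rows (?s (Suc k)) M) = pinv (top_rows (?s k) M) @\<^sub>c pinv (row_block r M k)"
      unfolding top_rows_Suc using Suc.prems M
      by (intro pinv_append_rows[of _ "?s k" n _ "r k"] top_orth) auto
    also have "\<dots> = concat_cols n (map (\<lambda>i. pinv (row_block r M i)) [0..<Suc k])"
      using Suc M concat_cols_snoc[of "pinv (row_block r M k)" n "r k"] by simp
    finally show ?case .
  qed
  moreover have "top_rows (?s p) M = M"
    using M m unfolding top_rows_def by (intro eq_matI) auto
  ultimately show ?thesis by (metis order_refl)
qed

section \<open>Orthogonality of permutation matrices and cancellation\<close>

lemma permutation_mat_orthogonal:
  assumes "permutation_mat k M"
  shows "M \<in> carrier_mat k k" "M * M\<^sup>T = 1\<^sub>m k" "M\<^sup>T * M = 1\<^sub>m k"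
proof -
  from assms obtain \<sigma> where \<sigma>: "\<sigma> permutes {..<k}"
    and M: "M = mat k k (\<lambda>(i, j). if j = \<sigma> i then 1 else 0)"
    unfolding permutation_mat_def by auto
  show carr: "M \<in> carrier_mat k k" by (simp add: M)
  show 1: "M * M\<^sup>T = 1\<^sub>m k"
  proof (rule eq_matI)
    fix i j assume "i < dim_row (1\<^sub>m k :: real mat)" "j < dim_col (1\<^sub>m k :: real mat)"
    then have ij: "i < k" "j < k" by auto
    have "(M * M\<^sup>T) $$ (i, j) = (\<Sum>l<k. (if l = \<sigma> i then 1 else 0) * (if l = \<sigma> j then 1 else 0))"
      using ij by (simp add: M scalar_prod_def atLeast0LessThan)
    also have "\<dots> = (\<Sum>l<k. if l = \<sigma> i then (if \<sigma> i = \<sigma> j then 1 else 0) else 0)"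
      by (intro sum.cong) auto
    also have "\<dots> = (if \<sigma> i = \<sigma> j then 1 else 0)"
      using permutes_in_image[OF \<sigma>, of i] ij by (simp add: sum.delta)
    also have "\<dots> = 1\<^sub>m k $$ (i, j)"
      using ij inj_eq[OF permutes_inj[OF \<sigma>]] by simp
    finally show "(M * M\<^sup>T) $$ (i, j) = 1\<^sub>m k $$ (i, j)" .
  qed (auto simp: M)
  show "M\<^sup>T * M = 1\<^sub>m k"
    using mat_mult_left_right_inverse[OF carr _ 1] carr by simp
qed

lemma mult_mat_vec_left_cancel:
  fixes M :: "'a :: comm_semiring_1 mat"
  assumes "L \<in> carrier_mat k k" "M \<in> carrier_mat k k" "L * M = 1\<^sub>m k"
    and "v \<in> carrier_vec k" "w \<in> carrier_vec k"
  shows "M *\<^sub>v v = M *\<^sub>v w \<longleftrightarrow> v = w"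
proof
  assume "M *\<^sub>v v = M *\<^sub>v w"
  then have "(L * M) *\<^sub>v v = (L * M) *\<^sub>v w" using assms(1,2,4,5) by simp
  then show "v = w" using assms by simp
qed simp

section \<open>Minimal norm solutions\<close>

lemma mult_transpose_mat_eq_0_scalar_prod:
  fixes M :: "real mat"
  assumes "M \<in> carrier_mat a k" "x \<in> carrier_vec a" "d \<in> carrier_vec k"
    and "M *\<^sub>v d = 0\<^sub>v a"
  shows "(M\<^sup>T *\<^sub>v x) \<bullet> d = 0"
  using assms by (simp add: transpose_vec_mult_scalar[of M a k])

text \<open>Pythagoras: a solution in the range of the transpose is orthogonal to the kernel,
  so no other solution can be shorter.\<close>

lemma min_norm_solution_eqI:
  assumes M: "M \<in> carrier_mat a k" and t: "t \<in> carrier_vec a"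
    and w: "is_solution M c (M\<^sup>T *\<^sub>v t)" and z: "is_min_norm_solution M c z"
  shows "z = M\<^sup>T *\<^sub>v t"
proof (rule ccontr)
  define w where "w = M\<^sup>T *\<^sub>v t"
  assume "z \<noteq> M\<^sup>T *\<^sub>v t"
  \<comment> \<open>Minimality is strict, so the other solution \<open>w\<close> must be longer; the
    identity below makes \<open>z\<close> at least as long as \<open>w\<close>.\<close>
  then have less: "euclidean_norm z < euclidean_norm w"
    using w z unfolding is_min_norm_solution_def w_def by auto
  have zc: "z \<in> carrier_vec k" "M *\<^sub>v z = c" and wc: "w \<in> carrier_vec k" "M *\<^sub>v w = c"
    using M w z unfolding is_min_norm_solution_def is_solution_def w_def by auto
  have cc: "c \<in> carrier_vec a" using M zc(1) zc(2)[symmetric] by simp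
  define d where "d = z - w"
  have d: "d \<in> carrier_vec k" using zc wc by (simp add: d_def)
  have "M *\<^sub>v d = 0\<^sub>v a"
    unfolding d_def using M zc wc cc by (simp add: mult_minus_distrib_mat_vec)
  then have wd: "w \<bullet> d = 0"
    unfolding w_def using mult_transpose_mat_eq_0_scalar_prod M t d by blast
  have "z = w + d" unfolding d_def using zc wc by (intro eq_vecI) auto
  then have "z \<bullet> z = w \<bullet> w + d \<bullet> d"
    using wd wc(1) d comm_scalar_prod[OF wc(1) d]
    by (simp add: add_scalar_prod_distrib[of _ k] scalar_prod_add_distrib[of _ k])
  moreover have "d \<bullet> d \<ge> 0" using conjugate_square_ge_0_vec[of d] by simp
  ultimately show False using less unfolding euclidean_norm_def by simp
qed

section \<open>The system augmented by orthogonal rows\<close>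

theorem proposition1:
  fixes m n q p :: nat
    and r :: "nat \<Rightarrow> nat"
    and At A Pm Q \<Gamma> Abar P Y W B S :: "real mat"
    and bt b :: "real vec"
  assumes "m \<le> n" and "1 \<le> q" and "1 \<le> p" and "p < m"
    and "At \<in> carrier_mat m n" and "vec_space.rank m At = m"
    and "bt \<in> carrier_vec m"
    and "permutation_mat m Pm" and "permutation_mat n Q"
    and "A = Pm * At * Q" and "b = Pm *\<^sub>v bt"
    and "(\<Sum>i<p. r i) = m"
    and "\<Gamma> \<in> carrier_mat m q"
    and "Abar = A @\<^sub>c \<Gamma>"
    and "\<And>i j. i < p \<Longrightarrow> j < p \<Longrightarrow> i \<noteq> j \<Longrightarrow>
           row_block r Abar i * transpose_mat (row_block r Abar j) = 0\<^sub>m (r i) (r j)"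
    and "P = pinv Abar * Abar"
    and "Y = 0\<^sub>m q n @\<^sub>c 1\<^sub>m q"
    and "W = Y * (1\<^sub>m (n + q) - P)"
    and "B \<in> carrier_mat q n" and "S \<in> carrier_mat q q" and "W = B @\<^sub>c S"
  shows
    \<comment> \<open>(i)\<close>
    "(Abar * transpose_mat W = 0\<^sub>m m q \<and>
      (\<forall>i<p. row_block r Abar i * transpose_mat W = 0\<^sub>m (r i) q)) \<and>
    \<comment> \<open>(ii)\<close>
     (pinv Abar = concat_cols (n + q) (map (\<lambda>i. pinv (row_block r Abar i)) [0..<p]) \<and>
      pinv (Abar @\<^sub>r W) = pinv Abar @\<^sub>c pinv W \<and>
      W * transpose_mat W = B * transpose_mat B + S ^\<^sub>m 2 \<and>
      B * transpose_mat B + S ^\<^sub>m 2 = S \<and>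
      S = Y * (1\<^sub>m (n + q) - P) * transpose_mat Y) \<and>
    \<comment> \<open>(iii)\<close>
     (\<forall>f. invertible_mat S \<and> f = - ((Y * pinv Abar) *\<^sub>v b) \<longrightarrow>
        (\<forall>x. is_solution A b x \<longrightarrow>
           is_solution (four_block_mat A \<Gamma> B S) (b @\<^sub>v f) (x @\<^sub>v 0\<^sub>v q)) \<and>
        (\<forall>x \<in> carrier_vec n. \<forall>y \<in> carrier_vec q.
           is_min_norm_solution (four_block_mat A \<Gamma> B S) (b @\<^sub>v f) (x @\<^sub>v y) \<longrightarrow>
           y = 0\<^sub>v q \<and> is_solution A b x)) \<and>
    \<comment> \<open>(iv)\<close>
     (\<forall>xt \<in> carrier_vec n.
        is_solution At bt xt \<longleftrightarrow> is_solution A b (transpose_mat Q *\<^sub>v xt))"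
proof -
  note At = \<open>At \<in> carrier_mat m n\<close> and \<Gamma> = \<open>\<Gamma> \<in> carrier_mat m q\<close>
    and B = \<open>B \<in> carrier_mat q n\<close> and S = \<open>S \<in> carrier_mat q q\<close>
    and bt = \<open>bt \<in> carrier_vec m\<close> and sum_r = \<open>(\<Sum>i<p. r i) = m\<close>
    and orth = assms(15) and W_BS = \<open>W = B @\<^sub>c S\<close>
  note Pm = permutation_mat_orthogonal[OF \<open>permutation_mat m Pm\<close>]
    and Q = permutation_mat_orthogonal[OF \<open>permutation_mat n Q\<close>]
  have A: "A \<in> carrier_mat m n" using At Pm Q \<open>A = Pm * At * Q\<close> by auto
  have b: "b \<in> carrier_vec m" using bt Pm \<open>b = Pm *\<^sub>v bt\<close> by auto
  have Abar: "Abar \<in> carrier_mat m (n + q)" using A \<Gamma> \<open>Abar = A @\<^sub>c \<Gamma>\<close> by auto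
  have Y: "Y \<in> carrier_mat q (n + q)" using \<open>Y = 0\<^sub>m q n @\<^sub>c 1\<^sub>m q\<close> by auto
  define X where "X = pinv Abar"
  have X: "X \<in> carrier_mat (n + q) m" using Abar by (auto simp: X_def)
  note pX = pinv[of Abar, folded X_def]
  have P_eq: "P = X * Abar" using \<open>P = pinv Abar * Abar\<close> by (simp add: X_def)
  have P: "P \<in> carrier_mat (n + q) (n + q)" using X Abar P_eq by auto
  have Pt: "P\<^sup>T = P" by (simp add: P_eq pX)
  \<comment> \<open>\<open>R\<close> is the orthogonal projector onto the kernel of
    \<open>Abar\<close>. Its symmetry, idempotence and annihilation by \<open>Abar\<close> and
    \<open>X\<close> carry parts (i) to (iii).\<close>
  define R where "R = 1\<^sub>m (n + q) - P"
  have R: "R \<in> carrier_mat (n + q) (n + q)" unfolding R_def using P by auto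
  have Rt: "R\<^sup>T = R"
    unfolding R_def using P Pt by (subst transpose_minus[of _ "n + q" "n + q"]) auto
  have AbarR: "Abar * R = 0\<^sub>m m (n + q)"
  proof -
    have "Abar * R = Abar - Abar * P"
      unfolding R_def using Abar P by (subst mult_minus_distrib_mat[of _ m "n + q"]) auto
    also have "Abar * P = Abar"
      unfolding P_eq using Abar X pX(2) by (simp add: mult_mat_assoc)
    finally show ?thesis using Abar by simp
  qed
  have RX: "R * X = 0\<^sub>m (n + q) m"
  proof -
    have "R * X = X - P * X"
      unfolding R_def using X P by (subst minus_mult_distrib_mat[of _ "n + q" "n + q"]) auto
    also have "P * X = X" by (simp add: P_eq pX)
    finally show ?thesis using X by simp
  qed
  have RR: "R * R = R"
  proof -
    have "R * R = R - P * R"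
      by (subst (1) R_def, subst minus_mult_distrib_mat[of _ "n + q" "n + q"]) (use R P in auto)
    also have "P * R = X * (Abar * R)"
      unfolding P_eq using X Abar R by (simp add: mult_mat_assoc)
    also have "\<dots> = 0\<^sub>m (n + q) (n + q)" unfolding AbarR using X by simp
    finally show ?thesis using R by (intro eq_matI) auto
  qed
  have W_eq: "W = Y * R" using \<open>W = Y * (1\<^sub>m (n + q) - P)\<close> by (simp add: R_def)
  have W: "W \<in> carrier_mat q (n + q)" using Y R W_eq by auto
  have Wt: "W\<^sup>T = R * Y\<^sup>T" unfolding W_eq using Y R Rt by (simp add: transpose_mat_mult)
  have AbarWt: "Abar * W\<^sup>T = 0\<^sub>m m q"
  proof -
    have "Abar * W\<^sup>T = Abar * R * Y\<^sup>T"
      unfolding Wt using Abar R Y by (simp add: mult_mat_assoc)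
    then show ?thesis using Y by (simp add: AbarR)
  qed
  have blockWt: "row_block r Abar i * W\<^sup>T = 0\<^sub>m (r i) q" if "i < p" for i
  proof -
    have "(\<Sum>l<Suc i. r l) \<le> (\<Sum>l<p. r l)" using that by (intro sum_mono2) auto
    then have le: "(\<Sum>l<i. r l) + r i \<le> m" using sum_r by simp
    have "row_block r Abar i * W\<^sup>T = row_block r (Abar * W\<^sup>T) i"
      using row_block_mult[OF Abar _ sum_r that] W by simp
    also have "\<dots> = 0\<^sub>m (r i) q"
      unfolding AbarWt row_block_def using le by (intro eq_matI) auto
    finally show ?thesis .
  qed

  \<comment> \<open>Right multiplication by \<open>Y\<^sup>T\<close> selects the last
    \<open>q\<close> columns, which identifies the given block \<open>S\<close> with
    \<open>Y * R * Y\<^sup>T\<close>.\<close>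
  have WYt: "W * Y\<^sup>T = S"
    unfolding W_BS \<open>Y = _\<close> using B S
    by (simp add: transpose_append_cols[of _ q n _ q] append_cols_mult_append_rows[of _ q n _ q _ q])
  have S_eq: "S = Y * R * Y\<^sup>T" using WYt by (simp add: W_eq)
  have St: "S\<^sup>T = S"
    unfolding S_eq using Y R by (simp add: transpose_mat_mult Rt mult_mat_assoc)
  have WWt: "W * W\<^sup>T = S"
  proof -
    have "W * W\<^sup>T = Y * (R * R) * Y\<^sup>T"
      by (simp only: Wt) (use Y R in \<open>simp add: W_eq mult_mat_assoc\<close>)
    then show ?thesis by (simp add: RR S_eq)
  qed
  have YWt: "Y * W\<^sup>T = S"
    unfolding Wt S_eq using Y R by (simp add: mult_mat_assoc)
  have WWt': "W * W\<^sup>T = B * B\<^sup>T + S ^\<^sub>m 2"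
  proof -
    have "W * W\<^sup>T = B * B\<^sup>T + S * S\<^sup>T"
      unfolding W_BS using B S
      by (simp add: transpose_append_cols[of _ q n _ q] append_cols_mult_append_rows[of _ q n _ q _ q])
    then show ?thesis using S by (simp add: St numeral_2_eq_2)
  qed
  have pinv_stack: "pinv (Abar @\<^sub>r W) = pinv Abar @\<^sub>c pinv W"
    using pinv_append_rows[OF Abar W AbarWt] .

  define M where "M = four_block_mat A \<Gamma> B S"
  \<comment> \<open>As a stack, \<open>M\<close> has transpose
    \<open>Abar\<^sup>T @\<^sub>c W\<^sup>T\<close>, so its range can be described through
    \<open>Abar\<close> and \<open>W\<close>.\<close>
  have M_eq: "M = Abar @\<^sub>r W"
    unfolding M_def W_BS \<open>Abar = A @\<^sub>c \<Gamma>\<close> using A \<Gamma> B S by (rule four_block_mat_append_rows_cols)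
  have M: "M \<in> carrier_mat (m + q) (n + q)" unfolding M_eq using Abar W by auto
  have M_vec: "M *\<^sub>v z = (Abar *\<^sub>v z) @\<^sub>v (W *\<^sub>v z)" if "z \<in> carrier_vec (n + q)" for z
    unfolding M_eq using mat_mult_append[OF Abar W that] .
  have Abar_vec: "Abar *\<^sub>v (x @\<^sub>v 0\<^sub>v q) = A *\<^sub>v x" if "x \<in> carrier_vec n" for x
  proof -
    have "\<Gamma> *\<^sub>v 0\<^sub>v q = 0\<^sub>v m" using \<Gamma> by (intro eq_vecI) auto
    then show ?thesis
      unfolding \<open>Abar = A @\<^sub>c \<Gamma>\<close> using A \<Gamma> that by (simp add: append_cols_mult_append_vec)
  qed
  have Y_vec: "Y *\<^sub>v (x @\<^sub>v y) = y" if "x \<in> carrier_vec n" "y \<in> carrier_vec q" for x y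
    unfolding \<open>Y = _\<close> using that
    by (simp add: append_cols_mult_append_vec[of _ q n _ q] zero_mat_mult_vec)

  have iii: "(\<forall>x. is_solution A b x \<longrightarrow> is_solution M (b @\<^sub>v f) (x @\<^sub>v 0\<^sub>v q)) \<and>
        (\<forall>x \<in> carrier_vec n. \<forall>y \<in> carrier_vec q.
           is_min_norm_solution M (b @\<^sub>v f) (x @\<^sub>v y) \<longrightarrow> y = 0\<^sub>v q \<and> is_solution A b x)"
    if "invertible_mat S" and f_eq: "f = - ((Y * X) *\<^sub>v b)" for f
  proof (intro conjI allI ballI impI)
    fix x assume "is_solution A b x"
    then have x: "x \<in> carrier_vec n" and Ax: "A *\<^sub>v x = b"
      using A unfolding is_solution_def by auto
    let ?z = "x @\<^sub>v 0\<^sub>v q"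
    have z: "?z \<in> carrier_vec (n + q)" using x by simp
    \<comment> \<open>Here \<open>W = Y - Y * X * Abar\<close>; as \<open>Y\<close> kills
      \<open>?z\<close> and \<open>Abar\<close> maps it to \<open>b\<close>, only \<open>f\<close>
      remains.\<close>
    have "W *\<^sub>v ?z = Y *\<^sub>v ?z - Y *\<^sub>v (X *\<^sub>v (Abar *\<^sub>v ?z))"
    proof -
      have "W *\<^sub>v ?z = Y *\<^sub>v (R *\<^sub>v ?z)" unfolding W_eq using Y R z by simp
      also have "R *\<^sub>v ?z = ?z - X *\<^sub>v (Abar *\<^sub>v ?z)"
        unfolding R_def using z P X Abar
        by (subst minus_mult_distrib_mat_vec[of _ "n + q" "n + q"]) (auto simp: P_eq)
      also have "Y *\<^sub>v \<dots> = Y *\<^sub>v ?z - Y *\<^sub>v (X *\<^sub>v (Abar *\<^sub>v ?z))"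
        using Y z X Abar by (intro mult_minus_distrib_mat_vec) auto
      finally show ?thesis .
    qed
    also have "\<dots> = f"
      using x Y X b by (simp add: Y_vec Abar_vec Ax f_eq)
    finally show "is_solution M (b @\<^sub>v f) ?z"
      using M z x unfolding is_solution_def by (simp add: M_vec Abar_vec Ax)
  next
    fix x y assume x: "x \<in> carrier_vec n" and y: "y \<in> carrier_vec q"
      and min: "is_min_norm_solution M (b @\<^sub>v f) (x @\<^sub>v y)"
    have z: "x @\<^sub>v y \<in> carrier_vec (n + q)" using x y by simp
    have f: "f \<in> carrier_vec q" unfolding f_eq using Y X b by auto
    have "M *\<^sub>v (x @\<^sub>v y) = b @\<^sub>v f"
      using min unfolding is_min_norm_solution_def is_solution_def by auto
    then have Az: "Abar *\<^sub>v (x @\<^sub>v y) = b"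
      unfolding M_vec[OF z] using append_vec_eq[OF mult_mat_vec_carrier[OF Abar z] b] by simp
    obtain S' where S': "S' \<in> carrier_mat q q" "S * S' = 1\<^sub>m q"
    proof -
      from \<open>invertible_mat S\<close> obtain S' where *: "S * S' = 1\<^sub>m q" "S' * S = 1\<^sub>m (dim_row S')"
        using S unfolding invertible_mat_def inverts_mat_def by auto
      \<comment> \<open>Invertibility supplies no size for \<open>S'\<close>; comparing column
        counts in the two equations recovers it.\<close>
      have "S' \<in> carrier_mat q q"
        using arg_cong[OF *(1), of dim_col] arg_cong[OF *(2), of dim_col] S by auto
      with * show ?thesis using that by blast
    qed
    \<comment> \<open>Both \<open>W * W\<^sup>T\<close> and \<open>Y * W\<^sup>T\<close> equal
      \<open>S\<close>, so this one \<open>u\<close> makes \<open>w\<close> satisfy the last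
      \<open>q\<close> equations and also makes its last \<open>q\<close> coordinates
      vanish.\<close>
    define u where "u = S' *\<^sub>v f"
    have u: "u \<in> carrier_vec q" and Su: "S *\<^sub>v u = f"
    proof -
      show "u \<in> carrier_vec q" unfolding u_def using S' f by auto
      have "S *\<^sub>v u = (S * S') *\<^sub>v f" unfolding u_def using S S'(1) f by simp
      then show "S *\<^sub>v u = f" using f by (simp add: S')
    qed
    \<comment> \<open>Since \<open>X = P\<^sup>T * X = Abar\<^sup>T * X\<^sup>T * X\<close>, this
      vector has \<open>Abar\<^sup>T *\<^sub>v t = X *\<^sub>v b\<close>.\<close>
    define t where "t = X\<^sup>T *\<^sub>v (X *\<^sub>v b)"
    have t: "t \<in> carrier_vec m" unfolding t_def using X b by auto
    define w where "w = X *\<^sub>v b + W\<^sup>T *\<^sub>v u"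
    have Xb: "X *\<^sub>v b \<in> carrier_vec (n + q)" and Wu: "W\<^sup>T *\<^sub>v u \<in> carrier_vec (n + q)"
      using X b W u by auto
    have "X *\<^sub>v b = (P\<^sup>T * X) *\<^sub>v b" by (simp add: Pt P_eq pX)
    also have "\<dots> = Abar\<^sup>T *\<^sub>v t"
      unfolding P_eq t_def using Abar X b Xb
      by (simp add: transpose_mat_mult mult_mat_vec_assoc)
    finally have "w = Abar\<^sup>T *\<^sub>v t + W\<^sup>T *\<^sub>v u" by (simp add: w_def)
    also have "\<dots> = M\<^sup>T *\<^sub>v (t @\<^sub>v u)"
      unfolding M_eq using Abar W t u
      by (simp add: append_cols_mult_append_vec[of "Abar\<^sup>T" "n + q" m "W\<^sup>T" q, symmetric]
          transpose_append_rows[of _ m "n + q" _ q])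
    finally have w_eq: "w = M\<^sup>T *\<^sub>v (t @\<^sub>v u)" .
    have w: "w \<in> carrier_vec (n + q)" unfolding w_def using Xb Wu by auto
    have "Abar *\<^sub>v w = (Abar * X) *\<^sub>v b + (Abar * W\<^sup>T) *\<^sub>v u"
      unfolding w_def using Abar X W b u Xb Wu by (simp add: mult_add_distrib_mat_vec)
    \<comment> \<open>The given solution shows that \<open>b\<close> lies in the range of
      \<open>Abar\<close>, where the projector \<open>Abar * X\<close> acts as the identity.\<close>
    also have "(Abar * X) *\<^sub>v b = (Abar * X * Abar) *\<^sub>v (x @\<^sub>v y)"
      using Abar X x y by (simp add: Az[symmetric] mult_mat_assoc mult_mat_vec_assoc)
    finally have "Abar *\<^sub>v w = b" using b u by (simp add: pX Az AbarWt zero_mat_mult_vec)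
    moreover have "W *\<^sub>v w = f"
    proof -
      have "W *\<^sub>v w = (W * X) *\<^sub>v b + (W * W\<^sup>T) *\<^sub>v u"
        unfolding w_def using Abar X W b u Xb Wu by (simp add: mult_add_distrib_mat_vec)
      also have "W * X = Y * (R * X)" unfolding W_eq using Y R X by (simp add: mult_mat_assoc)
      also have "\<dots> = 0\<^sub>m q m" unfolding RX using Y by simp
      finally show ?thesis using b f by (simp add: WWt Su zero_mat_mult_vec)
    qed
    ultimately have "is_solution M (b @\<^sub>v f) w"
      unfolding is_solution_def using M w by (simp add: M_vec)
    then have zw: "x @\<^sub>v y = w"
      unfolding w_eq using min_norm_solution_eqI[OF M _ _ min] t u by auto
    have "y = Y *\<^sub>v w" using Y_vec[OF x y] by (simp add: zw)
    also have "\<dots> = (Y * X) *\<^sub>v b + (Y * W\<^sup>T) *\<^sub>v u"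
      unfolding w_def using Y X W b u Xb Wu by (simp add: mult_add_distrib_mat_vec)
    also have "\<dots> = (Y * X) *\<^sub>v b + - ((Y * X) *\<^sub>v b)" by (simp only: YWt Su f_eq)
    also have "\<dots> = 0\<^sub>v q" using Y by (intro eq_vecI) auto
    finally show y0: "y = 0\<^sub>v q" .
    show "is_solution A b x"
      using Az A x unfolding y0 is_solution_def by (simp add: Abar_vec)
  qed

  have iv: "is_solution At bt xt \<longleftrightarrow> is_solution A b (Q\<^sup>T *\<^sub>v xt)" if xt: "xt \<in> carrier_vec n" for xt
  proof -
    \<comment> \<open>\<open>Q * Q\<^sup>T\<close> is the identity, so
      \<open>A * Q\<^sup>T = Pm * At\<close>, and the invertible \<open>Pm\<close> cancels from both
      sides.\<close>
    have "A *\<^sub>v (Q\<^sup>T *\<^sub>v xt) = (A * Q\<^sup>T) *\<^sub>v xt"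
      using A Q xt by (subst assoc_mult_mat_vec[of _ m n _ n]) auto
    also have "A * Q\<^sup>T = Pm * At * (Q * Q\<^sup>T)"
      unfolding \<open>A = Pm * At * Q\<close> using Pm(1) At Q(1) by (simp add: mult_mat_assoc)
    also have "\<dots> *\<^sub>v xt = Pm *\<^sub>v (At *\<^sub>v xt)"
      using Pm(1) At xt by (simp add: Q)
    finally have "A *\<^sub>v (Q\<^sup>T *\<^sub>v xt) = b \<longleftrightarrow> Pm *\<^sub>v (At *\<^sub>v xt) = Pm *\<^sub>v bt"
      by (simp add: \<open>b = Pm *\<^sub>v bt\<close>)
    also have "\<dots> \<longleftrightarrow> At *\<^sub>v xt = bt"
      using Pm At xt bt by (intro mult_mat_vec_left_cancel[of "Pm\<^sup>T" m]) auto
    finally show ?thesis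
      unfolding is_solution_def using xt A At Q by auto
  qed

  show ?thesis
    using AbarWt blockWt pinv_row_blocks[OF Abar sum_r orth] pinv_stack WWt WWt' S_eq iii iv
    unfolding M_def X_def R_def by auto
qed

end
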